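(* Let $N$ be a positive integer, $e$ a non-negative integer, $r$ a positive integer, and $\boldsymbol{k}=(k_1,\dots,k_r)$ an index of depth $r$. Let $\boldsymbol{k}^{\vee}$ be the Hoffman dual of $\boldsymbol{k}$ and let $s:=\mathrm{dep}(\boldsymbol{k}^{\vee})$. Then $$\sum_{\boldsymbol{e}\in J_{e,r}} b(\boldsymbol{k};\boldsymbol{e})\,H_N^{\star}(\boldsymbol{k}+\boldsymbol{e})=\sum_{j=0}^{e}\zeta_N^{\star}(\{1\}^{e-j})\sum_{\boldsymbol{e}'\in J_{j,s}}\zeta_N^{\star}(\boldsymbol{k}^{\vee}+\boldsymbol{e}').$$
   Context: An index is a tuple of positive integers $\boldsymbol{k}=(k_1,\dots,k_r)$; its depth is $\mathrm{dep}(\boldsymbol{k})=r$. The empty index is $\varnothing$. $\{1\}^m$ denotes $1,\dots,1$ repeated $m$ times (so $\{1\}^0=\varnothing$). Hoffman dual: every nonempty index can be written uniquely as $\boldsymbol{k}=(\{1\}^{a_1-1},b_1+1,\dots,\{1\}^{a_{t-1}-1},b_{t-1}+1,\{1\}^{a_t-1},b_t)$ with $t\ge 1$ and positive integers $a_1,\dots,a_t,b_1,\dots,b_t$; then $\boldsymbol{k}^{\vee}:=(a_1,\{1\}^{b_1-1},a_2+1,\{1\}^{b_2-1},\dots,a_t+1,\{1\}^{b_t-1})$ (for $t=1$: $\boldsymbol{k}^\vee=(a_1,\{1\}^{b_1-1})$). $J_{e,r}$ is the set of all tuples $\boldsymbol{e}=(e_1,\dots,e_r)$ of non-negative integers with $e_1+\cdots+e_r=e$.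 Sums of tuples of the same length are entrywise. For an index $\boldsymbol{k}=(k_1,\dots,k_r)$ and a tuple of non-negative integers $\boldsymbol{e}=(e_1,\dots,e_r)$, $$b(\boldsymbol{k};\boldsymbol{e}):=\prod_{i=1}^r\binom{k_i+e_i+\delta_{i1}+\delta_{ir}-2}{e_i},$$ where $\delta_{ij}$ is Kronecker's delta, with the convention $\binom{e-1}{e}=1$ if $e=0$ and $0$ if $e>0$. For an index $\boldsymbol{k}=(k_1,\dots,k_r)$ and positive integer $N$, $$H_N^{\star}(\boldsymbol{k}):=\sum_{1\le m_1\le\cdots\le m_r\le N}\frac{(-1)^{m_r-1}}{m_1^{k_1}\cdots m_r^{k_r}}\binom{N}{m_r},\qquad \zeta_N^{\star}(\boldsymbol{k}):=\sum_{1\le m_1\le\cdots\le m_r\le N}\frac{1}{m_1^{k_1}\cdots m_r^{k_r}},$$ and $\zeta_N^{\star}(\varnothing):=1$. *)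

theory Defs
  imports Complex_Main
begin

text \<open>Indices are lists of positive naturals (the empty index is \<open>[]\<close>, the depth is \<open>length\<close>).
  List positions are counted from 0, so the entries of a list of length \<open>r\<close> sit at
  positions \<open>0, \<dots>, r - 1\<close>.\<close>

definition is_index :: "nat list \<Rightarrow> bool" where
  "is_index k \<longleftrightarrow> (\<forall>x \<in> set k. 0 < x)"

text \<open>A list \<open>[(a\<^sub>1, b\<^sub>1), \<dots>, (a\<^sub>t, b\<^sub>t)]\<close> encodes the parameters of the decomposition
  \<open>({1}^(a\<^sub>1-1), b\<^sub>1+1, \<dots>, {1}^(a\<^sub>t\<^sub>-\<^sub>1-1), b\<^sub>t\<^sub>-\<^sub>1+1, {1}^(a\<^sub>t-1), b\<^sub>t)\<close> used to define the
  Hoffman dual; the last block has \<open>b\<^sub>t\<close> instead of \<open>b\<^sub>t+1\<close>.\<close>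

definition is_blocks :: "(nat \<times> nat) list \<Rightarrow> bool" where
  "is_blocks ps \<longleftrightarrow> ps \<noteq> [] \<and> (\<forall>(a, b) \<in> set ps. 0 < a \<and> 0 < b)"

fun index_of_blocks :: "(nat \<times> nat) list \<Rightarrow> nat list" where
  "index_of_blocks [] = []"
| "index_of_blocks [(a, b)] = replicate (a - 1) 1 @ [b]"
| "index_of_blocks ((a, b) # p # ps) = replicate (a - 1) 1 @ [b + 1] @ index_of_blocks (p # ps)"

fun dual_of_blocks :: "(nat \<times> nat) list \<Rightarrow> nat list" where
  "dual_of_blocks [] = []"
| "dual_of_blocks ((a, b) # ps) =
     a # replicate (b - 1) 1 @ concat (map (\<lambda>(a', b'). (a' + 1) # replicate (b' - 1) 1) ps)"

definition hoffman_dual :: "nat list \<Rightarrow> nat list" where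
  "hoffman_dual k = dual_of_blocks (THE ps. is_blocks ps \<and> index_of_blocks ps = k)"

fun blocks_of_index :: "nat list \<Rightarrow> (nat \<times> nat) list" where
  "blocks_of_index [] = []"
| "blocks_of_index [x] = [(1, x)]"
| "blocks_of_index (x # y # ys) =
     (if x = 1 then (case blocks_of_index (y # ys) of (a, b) # ps \<Rightarrow> (a + 1, b) # ps | [] \<Rightarrow> [])
      else (1, x - 1) # blocks_of_index (y # ys))"

lemma index_of_blocks_neq_Nil: "ps \<noteq> [] \<Longrightarrow> index_of_blocks ps \<noteq> []"
  by (induction ps rule: index_of_blocks.induct) auto

lemma index_of_blocks_Suc:
  "0 < a \<Longrightarrow> index_of_blocks ((Suc a, b) # ps) = 1 # index_of_blocks ((a, b) # ps)"
  by (cases ps; cases a) auto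

lemma blocks_of_index_correct:
  "k \<noteq> [] \<Longrightarrow> is_index k \<Longrightarrow>
     is_blocks (blocks_of_index k) \<and> index_of_blocks (blocks_of_index k) = k"
proof (induction k rule: blocks_of_index.induct)
  case (3 x y ys)
  obtain a b ps where eq: "blocks_of_index (y # ys) = (a, b) # ps"
    using 3 by (cases "x = 1"; cases "blocks_of_index (y # ys)")
      (auto simp: is_blocks_def is_index_def)
  show ?case
    using 3 eq by (cases "x = 1")
      (auto simp: is_blocks_def is_index_def index_of_blocks_Suc)
qed (auto simp: is_blocks_def is_index_def)

lemma blocks_of_index_unique:
  "is_blocks ps \<Longrightarrow> blocks_of_index (index_of_blocks ps) = ps"
proof (induction ps)
  case (Cons p ps)
  obtain a b where p: "p = (a, b)" by (cases p)
  have pos: "0 < a" "0 < b" using Cons.prems by (auto simp: is_blocks_def p)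
  have "blocks_of_index (index_of_blocks ((Suc n, b) # ps)) = (Suc n, b) # ps" for n
  proof (induction n)
    case 0
    show ?case
    proof (cases ps)
      case (Cons q qs)
      then have "blocks_of_index (index_of_blocks ps) = ps"
        using Cons.IH Cons.prems by (auto simp: is_blocks_def)
      moreover obtain y ys where "index_of_blocks ps = y # ys"
        using index_of_blocks_neq_Nil[of ps] Cons by (cases "index_of_blocks ps") auto
      ultimately show ?thesis using Cons pos by auto
    qed auto
  next
    case (Suc n)
    obtain y ys where "index_of_blocks ((Suc n, b) # ps) = y # ys"
      using index_of_blocks_neq_Nil[of "(Suc n, b) # ps"]
      by (cases "index_of_blocks ((Suc n, b) # ps)") auto
    then show ?case using Suc by (simp add: index_of_blocks_Suc[of "Suc n"])
  qed
  from this[of "a - 1"] show ?case using pos p by simp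
qed (simp add: is_blocks_def)

lemma ex1_blocks:
  assumes "k \<noteq> []" "is_index k"
  shows "\<exists>!ps. is_blocks ps \<and> index_of_blocks ps = k"
  using blocks_of_index_correct[OF assms] blocks_of_index_unique by metis

lemma hoffman_dual_index_of_blocks:
  assumes "is_blocks ps"
  shows "hoffman_dual (index_of_blocks ps) = dual_of_blocks ps"
proof -
  have "(THE qs. is_blocks qs \<and> index_of_blocks qs = index_of_blocks ps) = ps"
    using assms blocks_of_index_unique by (intro the_equality) metis+
  then show ?thesis by (simp add: hoffman_dual_def)
qed

definition J :: "nat \<Rightarrow> nat \<Rightarrow> nat list set" where
  "J e r = {es. length es = r \<and> sum_list es = e}"

lemma finite_J: "finite (J e r)"
proof (rule finite_subset)
  show "J e r \<subseteq> {es. set es \<subseteq> {..e} \<and> length es = r}"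
    by (auto simp: J_def member_le_sum_list)
  show "finite {es. set es \<subseteq> {..e} \<and> length es = r}"
    by (rule finite_lists_length_eq) simp
qed

definition tuple_add :: "nat list \<Rightarrow> nat list \<Rightarrow> nat list" where
  "tuple_add k es = map2 (+) k es"

text \<open>The upper entry of the binomial coefficient is at least \<open>e\<^sub>i - 1\<close>. Truncated subtraction
  gives \<open>0 choose 0 = 1\<close> when \<open>e\<^sub>i = 0\<close> and this entry would be \<open>-1\<close>, which is the convention
  \<open>(-1 choose 0) = 1\<close>.\<close>

definition b_coeff :: "nat list \<Rightarrow> nat list \<Rightarrow> nat" where
  "b_coeff k es = (\<Prod>i<length k.
     (k ! i + es ! i + of_bool (i = 0) + of_bool (i = length k - 1) - 2) choose (es ! i))"

definition weak_chains :: "nat \<Rightarrow> nat \<Rightarrow> nat list set" where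
  "weak_chains N r = {m. length m = r \<and> sorted m \<and> set m \<subseteq> {1..N}}"

lemma finite_weak_chains: "finite (weak_chains N r)"
proof (rule finite_subset)
  show "weak_chains N r \<subseteq> {m. set m \<subseteq> {1..N} \<and> length m = r}"
    by (auto simp: weak_chains_def)
  show "finite {m. set m \<subseteq> {1..N} \<and> length m = r}"
    by (rule finite_lists_length_eq) simp
qed

text \<open>\<open>H_star\<close> is meaningful for nonempty indices only.\<close>

definition H_star :: "nat \<Rightarrow> nat list \<Rightarrow> real" where
  "H_star N k = (\<Sum>m \<in> weak_chains N (length k).
     (-1) ^ (last m - 1) / (\<Prod>i<length k. real (m ! i) ^ (k ! i)) * real (N choose last m))"

definition zeta_star :: "nat \<Rightarrow> nat list \<Rightarrow> real" where
  "zeta_star N k = (\<Sum>m \<in> weak_chains N (length k).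
     1 / (\<Prod>i<length k. real (m ! i) ^ (k ! i)))"

lemma zeta_star_Nil: "zeta_star N [] = 1"
proof -
  have "weak_chains N 0 = {[]}" by (auto simp: weak_chains_def)
  then show ?thesis by (simp add: zeta_star_def)
qed

end

theory Submission
  imports Defs "HOL-Computational_Algebra.Formal_Power_Series"
begin

text \<open>
  Multiplying the identity for \<open>e\<close> by \<open>X ^ e\<close> and summing over \<open>e\<close> turns the family of identities
  into a single one between formal power series. Since
  \<open>1 / (m - X) ^ p = (\<Sum>e. (p + e - 1 choose e) * X ^ e / m ^ (p + e))\<close>, the coefficients
  \<open>b(k; e)\<close> are exactly those that make the left-hand side an alternating sum over chains
  \<open>m\<^sub>1 \<le> \<dots> \<le> m\<^sub>r\<close> with weights \<open>1 / (m\<^sub>i * (m\<^sub>i - X) ^ (k\<^sub>i - 1))\<close>, the first and the last of them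
  multiplied by \<open>m\<^sub>i / (m\<^sub>i - X)\<close>. The right-hand side becomes \<open>\<Prod>i\<le>N. i / (i - X)\<close>, whose
  coefficients are \<open>\<zeta>\<^sup>\<star>\<^sub>N({1}\<^sup>j)\<close>, times a chain sum for the dual index with weights
  \<open>1 / (m\<^sub>i ^ (k\<^sub>i - 1) * (m\<^sub>i - X))\<close>.

  Both chain sums are built from the one-letter sequence \<open>1 / (n - X)\<close> by a word in two operators:
  an entry \<open>x\<close> of the index contributes one operator that takes partial sums, followed by
  \<open>x - 1\<close> multiplication operators. On the left these are
  \<open>a \<mapsto> (1/n) * (\<Sum>m\<le>n. a m)\<close> and \<open>a \<mapsto> a n / (n - X)\<close>; on the right they are
  \<open>a \<mapsto> 1/(n - X) * (\<Sum>m\<le>n. a m)\<close> and \<open>a \<mapsto> a n / n\<close>. In terms of words the Hoffman dual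
  only exchanges the two letters after the first one (\<open>word_hoffman_dual\<close>).

  What remains is that the binomial transform
  \<open>T a n = (\<Sum>m=1..n. (-1) ^ (m - 1) * (n - 1 choose m - 1) * a m)\<close>, divided by
  \<open>\<Prod>i<n. i / (i - X)\<close>, conjugates the partial-sum operator of the left into the multiplication
  operator of the right (\<open>transforms_to_step_recip\<close>) and the multiplication operator of the left into
  the partial-sum operator of the right (\<open>transforms_to_mult_pole\<close>), and fixes the initial sequence
  (\<open>transforms_to_pole\<close>). Hence it carries the sequence of the left-hand side to the sequence of
  the right-hand side. The extra factor \<open>m\<^sub>r / (m\<^sub>r - X)\<close> at the last position together with the sign and the
  coefficient \<open>N choose m\<^sub>r\<close> is \<open>N\<close> times the transform after one more multiplication operator, so it
  becomes the outer sum over \<open>m\<^sub>s \<le> N\<close> on the right (\<open>sum_binomial_eq_Z_psum\<close>).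
\<close>

unbundle fps_syntax

section \<open>The Hoffman dual as an exchange of letters\<close>

text \<open>The letter \<open>False\<close> opens a new entry of the index and each \<open>True\<close> increases the current
  entry by 1. The first letter is always \<open>False\<close> and carries no information; it is the one letter
  that duality does not exchange.\<close>

definition word :: "nat list \<Rightarrow> bool list" where
  "word k = concat (map (\<lambda>x. False # replicate (x - 1) True) k)"

definition inc_hd :: "nat list \<Rightarrow> nat list" where
  "inc_hd k = Suc (hd k) # tl k"

lemma hoffman_dual_eq_blocks:
  assumes "k \<noteq> []" "is_index k"
  shows "hoffman_dual k = dual_of_blocks (blocks_of_index k)"
  using blocks_of_index_correct[OF assms] hoffman_dual_index_of_blocks by metis

lemma hoffman_dual_singleton:
  assumes "0 < x"
  shows "hoffman_dual [x] = replicate x 1"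
  using assms by (cases x) (auto simp: hoffman_dual_eq_blocks is_index_def)

text \<open>Prepending \<open>1\<close> enlarges the first block parameter \<open>a\<^sub>1\<close> of \<open>l\<close> by one, and \<open>a\<^sub>1\<close> is
  the first entry of the dual. Prepending \<open>x > 1\<close> opens the new block \<open>(1, x - 1)\<close>, which
  contributes \<open>x - 1\<close> ones to the dual, and the old first entry \<open>a\<^sub>1\<close> becomes \<open>a\<^sub>1 + 1\<close>. Both cases
  have the same closed form.\<close>

lemma hoffman_dual_Cons:
  assumes "0 < x" "l \<noteq> []" "is_index l"
  shows "hoffman_dual (x # l) = replicate (x - 1) 1 @ inc_hd (hoffman_dual l)"
proof -
  obtain y ys where l: "l = y # ys" using assms(2) by (cases l) auto
  have "is_blocks (blocks_of_index l)"
    using blocks_of_index_correct assms by blast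
  then obtain a b ps where ps: "blocks_of_index l = (a, b) # ps"
    by (cases "blocks_of_index l") (auto simp: is_blocks_def)
  have "is_index (x # l)" using assms by (auto simp: is_index_def)
  moreover have "replicate (x - Suc 0) (1::nat) = 1 # replicate (x - 2) 1" if "x \<noteq> 1"
    using that assms(1) by (cases x; cases "x - 1") auto
  ultimately show ?thesis
    using assms ps l by (auto simp: hoffman_dual_eq_blocks inc_hd_def numeral_2_eq_2)
qed

lemma is_index_hoffman_dual:
  "k \<noteq> [] \<Longrightarrow> is_index k \<Longrightarrow> hoffman_dual k \<noteq> [] \<and> is_index (hoffman_dual k)"
proof (induction k)
  case (Cons x l)
  have x: "0 < x" and l: "is_index l" using Cons.prems by (auto simp: is_index_def)
  show ?case
  proof (cases "l = []")
    case True
    then show ?thesis using x by (auto simp: hoffman_dual_singleton is_index_def)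
  next
    case False
    then show ?thesis using Cons.IH x l
      by (cases "hoffman_dual l") (auto simp: hoffman_dual_Cons is_index_def inc_hd_def)
  qed
qed simp

lemma word_append: "word (k @ l) = word k @ word l"
  by (simp add: word_def)

lemma word_replicate_1: "word (replicate n 1) = replicate n False"
  by (induction n) (auto simp: word_def)

lemma word_inc_hd:
  "k \<noteq> [] \<Longrightarrow> is_index k \<Longrightarrow> word (inc_hd k) = False # True # tl (word k)"
  by (cases k; cases "hd k") (auto simp: word_def inc_hd_def is_index_def)

text \<open>By induction along \<open>hoffman_dual_Cons\<close>: the entry \<open>x\<close> contributes the letters
  \<open>True\<close> (\<open>x - 1\<close> times) and then the \<open>False\<close> that opens the next entry; in the dual
  these become \<open>x - 1\<close> openings and one increment.\<close>

lemma word_hoffman_dual: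
  "k \<noteq> [] \<Longrightarrow> is_index k \<Longrightarrow> word (hoffman_dual k) = False # map Not (tl (word k))"
proof (induction k)
  case (Cons x l)
  have x: "0 < x" and l: "is_index l" using Cons.prems by (auto simp: is_index_def)
  obtain x' where x': "x = Suc x'" using x by (cases x) auto
  show ?case
  proof (cases "l = []")
    case True
    then show ?thesis
      using x' word_replicate_1[of x]
      by (simp add: hoffman_dual_singleton[OF x, unfolded x'] word_def del: replicate_Suc)
        (simp add: word_def)
  next
    case False
    have "word (hoffman_dual (x # l)) =
        replicate x' False @ False # True # map Not (tl (word l))"
      using Cons.IH[OF False l] is_index_hoffman_dual[OF False l]
      by (simp add: hoffman_dual_Cons[OF x False l, unfolded x'] word_append x' word_inc_hd
          word_replicate_1[simplified])
    also have "\<dots> = False # replicate x' False @ map Not (word l)"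
    proof -
      have w: "word l = False # tl (word l)"
        using False by (cases l) (auto simp: word_def)
      have "map Not (word l) = True # map Not (tl (word l))"
        by (subst w) simp
      then show ?thesis by (simp add: replicate_app_Cons_same)
    qed
    also have "\<dots> = False # map Not (tl (word (x # l)))"
      by (simp add: word_def x')
    finally show ?thesis .
  qed
qed simp

section \<open>Chain sums as iterated partial sums\<close>

definition psum :: "(nat \<Rightarrow> 'a::comm_ring_1) \<Rightarrow> nat \<Rightarrow> 'a" where
  "psum a n = (\<Sum>m=1..n. a m)"

lemma psum_Suc: "psum a (Suc n) = psum a n + a (Suc n)"
  by (simp add: psum_def)

definition step :: "(nat \<Rightarrow> 'a::comm_ring_1) \<Rightarrow> (nat \<Rightarrow> 'a) \<Rightarrow> nat \<Rightarrow> 'a" where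
  "step w a n = w n * psum a n"

lemma sum_weak_chains_Suc:
  fixes f :: "nat list \<Rightarrow> 'a::comm_monoid_add"
  shows "(\<Sum>m \<in> weak_chains N (Suc r). f m) = (\<Sum>n=1..N. \<Sum>m \<in> weak_chains n r. f (m @ [n]))"
proof -
  have *: "weak_chains N (Suc r) =
      (\<lambda>(n, m). m @ [n]) ` (SIGMA n:{1..N}. weak_chains n r)" (is "?L = ?R")
  proof
    show "?L \<subseteq> ?R"
    proof
      fix l assume l: "l \<in> ?L"
      then obtain m n where mn: "l = m @ [n]"
        by (cases l rule: rev_cases) (auto simp: weak_chains_def)
      with l have "(n, m) \<in> (SIGMA n:{1..N}. weak_chains n r)"
        by (auto simp: weak_chains_def sorted_append)
      then show "l \<in> ?R" using mn by force
    qed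
    show "?R \<subseteq> ?L" by (fastforce simp: weak_chains_def sorted_append)
  qed
  show ?thesis
    unfolding *
    by (subst sum.reindex)
      (auto simp: inj_on_def sum.Sigma finite_weak_chains case_prod_beta)
qed

text \<open>Splitting off the largest element of a chain repeatedly computes a chain sum from
  the inside to the outside. The weight \<open>g\<close> of the smallest element serves as the initial
  sequence, and the factor \<open>h\<close> at the largest element leaves room for the sign and the binomial
  coefficient in \<open>H_star\<close>.\<close>

lemma sum_weak_chains_eq_fold_step:
  fixes g h :: "nat \<Rightarrow> 'a::comm_ring_1"
  shows "(\<Sum>m \<in> weak_chains N (Suc (length ws)).
      h (last m) * (g (m ! 0) * (\<Prod>i<length ws. (ws ! i) (m ! Suc i)))) =
    (\<Sum>n=1..N. h n * fold step ws g n)"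
proof (induction ws arbitrary: N h rule: rev_induct)
  case Nil
  have "weak_chains n 0 = {[]}" for n by (auto simp: weak_chains_def)
  then show ?case by (simp add: sum_weak_chains_Suc)
next
  case (snoc w ws)
  have "(\<Sum>m \<in> weak_chains n (Suc (length ws)). h (last (m @ [n])) *
        (g ((m @ [n]) ! 0) * (\<Prod>i<length (ws @ [w]). ((ws @ [w]) ! i) ((m @ [n]) ! Suc i))))
      = h n * (w n * (\<Sum>m \<in> weak_chains n (Suc (length ws)).
          1 * (g (m ! 0) * (\<Prod>i<length ws. (ws ! i) (m ! Suc i)))))" for n
    unfolding sum_distrib_left
  proof (rule sum.cong[OF refl])
    fix m assume "m \<in> weak_chains n (Suc (length ws))"
    then have len: "length m = Suc (length ws)" by (simp add: weak_chains_def)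
    have "(\<Prod>i<length ws. ((ws @ [w]) ! i) ((m @ [n]) ! Suc i)) =
        (\<Prod>i<length ws. (ws ! i) (m ! Suc i))"
      by (rule prod.cong) (auto simp: nth_append len)
    then show "h (last (m @ [n])) *
        (g ((m @ [n]) ! 0) * (\<Prod>i<length (ws @ [w]). ((ws @ [w]) ! i) ((m @ [n]) ! Suc i))) =
        h n * (w n * (1 * (g (m ! 0) * (\<Prod>i<length ws. (ws ! i) (m ! Suc i)))))"
      by (simp add: nth_append len mult_ac)
  qed
  then show ?case
    by (subst length_append_singleton, subst sum_weak_chains_Suc)
      (simp add: snoc.IH[where h = "\<lambda>_. 1", simplified] step_def psum_def)
qed

text \<open>
  The operator of a letter: multiplication by \<open>p\<close> for \<open>True\<close>, and partial summation with
  weight \<open>q\<close> for \<open>False\<close>. The two sides of the theorem use the same two weights in exchanged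
  roles.
\<close>

definition letter ::
  "(nat \<Rightarrow> 'a::comm_ring_1) \<Rightarrow> (nat \<Rightarrow> 'a) \<Rightarrow> bool \<Rightarrow> (nat \<Rightarrow> 'a) \<Rightarrow> nat \<Rightarrow> 'a" where
  "letter p q b a = (if b then \<lambda>n. p n * a n else step q a)"

lemma fold_letter_replicate_True:
  "fold (letter p q) (replicate j True) a = (\<lambda>n. p n ^ j * a n)"
  by (induction j arbitrary: a) (auto simp: letter_def mult_ac)

lemma fold_letter_word:
  "fold (letter p q) (word l) a = fold step (map (\<lambda>y n. p n ^ (y - 1) * q n) l) a"
proof (induction l arbitrary: a)
  case (Cons x l)
  have "fold (letter p q) (False # replicate (x - 1) True) a = step (\<lambda>n. p n ^ (x - 1) * q n) a"
    unfolding fold_Cons comp_def fold_letter_replicate_True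
    by (simp add: letter_def step_def[abs_def] mult_ac)
  moreover have "word (x # l) = (False # replicate (x - 1) True) @ word l"
    by (simp add: word_def)
  ultimately show ?case
    by (simp only: fold_append comp_def Cons.IH list.map fold_Cons)
qed (simp add: word_def)

text \<open>The opening letter of the first entry is dropped, so that the initial sequence \<open>a\<close> stands
  for the innermost weight itself instead of being summed.\<close>

lemma fold_letter_tl_word:
  "fold (letter p q) (tl (word (x # l))) a =
    fold step (map (\<lambda>y n. p n ^ (y - 1) * q n) l) (\<lambda>n. p n ^ (x - 1) * a n)"
proof -
  have "tl (word (x # l)) = replicate (x - 1) True @ word l"
    by (simp add: word_def)
  then show ?thesis
    by (simp only: fold_append comp_def fold_letter_replicate_True fold_letter_word)
qed

section \<open>The two weights and their power series coefficients\<close>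

definition pole :: "nat \<Rightarrow> real fps" where
  "pole n = inverse (of_nat n - fps_X)"

definition recip :: "nat \<Rightarrow> real fps" where
  "recip n = fps_const (1 / real n)"

lemma pole_mult: "0 < n \<Longrightarrow> (of_nat n - fps_X) * pole n = 1"
  unfolding pole_def by (subst mult.commute, rule inverse_mult_eq_1) simp

lemma recip_mult: "0 < n \<Longrightarrow> of_nat n * recip n = 1"
  by (simp add: recip_def fps_of_nat[symmetric])

text \<open>The recursion \<open>(n - X) * v (p + 1) = v p\<close> for the series on the right is Pascal's rule. For \<open>p = 0\<close> the truncated
  upper entry \<open>e - 1\<close> gives 1 for \<open>e = 0\<close> and 0 otherwise, the coefficients of the
  series 1.\<close>

lemma pole_power:
  assumes "0 < n"
  shows "pole n ^ p = Abs_fps (\<lambda>e. real ((p + e - 1) choose e) / real n ^ (p + e))"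
proof (induction p)
  case 0
  show ?case by (rule fps_ext) (auto simp: gr0_conv_Suc)
next
  case (Suc p)
  let ?v = "\<lambda>p. Abs_fps (\<lambda>e. real ((p + e - 1) choose e) / real n ^ (p + e))"
  have "(of_nat n - fps_X) * ?v (Suc p) = ?v p"
  proof (rule fps_ext)
    fix e
    show "((of_nat n - fps_X) * ?v (Suc p)) $ e = ?v p $ e"
    proof (cases e)
      case 0
      then show ?thesis using assms by (simp add: left_diff_distrib fps_mult_of_nat_nth)
    next
      case (Suc d)
      have "real ((p + Suc d) choose Suc d) = real ((p + d) choose d) + real ((p + d) choose Suc d)"
        by simp
      then show ?thesis
        using assms by (simp add: Suc left_diff_distrib fps_mult_of_nat_nth divide_simps)
    qed
  qed
  then have "pole n * ?v p = pole n * ((of_nat n - fps_X) * ?v (Suc p))"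
    by (rule arg_cong[OF sym])
  also have "\<dots> = (of_nat n - fps_X) * pole n * ?v (Suc p)"
    by (simp only: mult_ac)
  finally have "pole n * ?v p = (of_nat n - fps_X) * pole n * ?v (Suc p)" .
  then show ?case using Suc by (simp add: pole_mult[OF assms])
qed

lemma pole_eq: "0 < n \<Longrightarrow> pole n = Abs_fps (\<lambda>e. 1 / real n ^ (e + 1))"
  using pole_power[of n 1] by simp

lemma recip_power: "recip n ^ p = fps_const (1 / real n ^ p)"
  by (simp add: recip_def fps_const_power power_one_over)

lemma zeta_weight_nth:
  assumes "0 < n" "0 < y"
  shows "(recip n ^ (y - 1) * pole n) $ e = 1 / real n ^ (y + e)"
proof -
  obtain z where "y = Suc z" using assms by (cases y) auto
  then show ?thesis
    using assms by (simp add: recip_power pole_eq power_add)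
qed

text \<open>This explains the shape of \<open>b_coeff\<close>: the exponent \<open>d\<close> counts how often the position is an
  end of the index (0, 1, or 2 for an index of depth 1).\<close>

lemma H_weight_nth:
  assumes "0 < n" "0 < y"
  shows "((of_nat n * pole n) ^ d * (pole n ^ (y - 1) * recip n)) $ e =
    real ((y + e + d - 2) choose e) / real n ^ (y + e)"
proof -
  obtain z where y: "y = Suc z" using assms by (cases y) auto
  have eq: "(of_nat n * pole n) ^ d * (pole n ^ (y - 1) * recip n) =
      fps_const (real n ^ d / real n) * pole n ^ (d + z)"
    by (simp add: recip_def power_mult_distrib power_add y fps_of_nat[symmetric] mult_ac)
  have top: "d + z + e - 1 = y + e + d - 2" by (simp add: y)
  have bot: "real n ^ d / real n * (c / real n ^ (d + z + e)) = c / real n ^ (y + e)" for c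
    using assms(1) by (simp add: y power_add field_simps)
  show ?thesis
    unfolding eq
    unfolding fps_mult_left_const_nth pole_power[OF assms(1)] fps_nth_Abs_fps bot top ..
qed

lemma fps_prod_nth_J:
  fixes a :: "nat \<Rightarrow> real fps"
  assumes "0 < r"
  shows "(\<Prod>i<r. a i) $ e = (\<Sum>es \<in> J e r. \<Prod>i<r. a i $ (es ! i))"
proof -
  obtain q where r: "r = Suc q" using assms by (cases r) auto
  have "J e r = natpermute e (q + 1)"
    by (auto simp: J_def natpermute_def r)
  moreover have "{..<r} = {0..q}" by (auto simp: r)
  ultimately show ?thesis using fps_prod_nth[of a q e] by simp
qed

section \<open>The binomial transform exchanges the letters\<close>

definition btrans :: "(nat \<Rightarrow> 'a::comm_ring_1) \<Rightarrow> nat \<Rightarrow> 'a" where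
  "btrans a n = (\<Sum>m=1..n. (- 1) ^ (m - 1) * of_nat ((n - 1) choose (m - 1)) * a m)"

lemma btrans_Suc: "btrans a (Suc n) = (\<Sum>i\<le>n. (- 1) ^ i * of_nat (n choose i) * a (Suc i))"
  unfolding btrans_def
  by (rule sum.reindex_bij_witness[of _ Suc "\<lambda>m. m - 1"]) auto

text \<open>Summation by parts: Pascal's rule for \<open>Suc n choose Suc i\<close> makes the sum telescope up to the terms with the factor
  \<open>psum a (Suc i) - psum a i = a (Suc i)\<close>.\<close>

lemma sum_alternating_binomial_psum:
  "(\<Sum>i\<le>n. (- 1) ^ i * of_nat (Suc n choose Suc i) * psum a (Suc i)) = btrans a (Suc n)"
proof -
  define t where "t i = (- 1) ^ i * of_nat (n choose i) * psum a i" for i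
  have "(\<Sum>i\<le>n. (- 1) ^ i * of_nat (Suc n choose Suc i) * psum a (Suc i)) =
      (\<Sum>i\<le>n. (t i - t (Suc i)) + (- 1) ^ i * of_nat (n choose i) * a (Suc i))"
    by (rule sum.cong) (simp_all add: t_def psum_Suc algebra_simps)
  also have "\<dots> = t 0 - t (Suc n) + btrans a (Suc n)"
    by (simp add: sum.distrib sum_telescope btrans_Suc)
  also have "\<dots> = btrans a (Suc n)"
    by (simp add: t_def psum_def binomial_eq_0)
  finally show ?thesis .
qed

text \<open>The weight \<open>1 / (i + 1)\<close> is absorbed by
  \<open>(n + 1) * (n choose i) = (i + 1) * (n + 1 choose i + 1)\<close>, which leaves the sum of the preceding lemma.\<close>

lemma btrans_step_recip:
  "btrans (step recip a) (Suc n) = recip (Suc n) * btrans a (Suc n)"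
proof -
  have "of_nat (Suc n) * btrans (step recip a) (Suc n) =
      (\<Sum>i\<le>n. (- 1) ^ i * of_nat (Suc n choose Suc i) * psum a (Suc i))"
    unfolding btrans_Suc sum_distrib_left
  proof (rule sum.cong[OF refl])
    fix i
    have "of_nat (Suc n) * of_nat (n choose i) * recip (Suc i) =
        of_nat (Suc n choose Suc i) * (of_nat (Suc i) * recip (Suc i))"
      unfolding mult.assoc[symmetric] of_nat_mult[symmetric]
      by (simp only: Suc_times_binomial mult.commute)
    then have *: "of_nat (Suc n) * of_nat (n choose i) * recip (Suc i) =
        of_nat (Suc n choose Suc i)"
      by (simp only: recip_mult zero_less_Suc mult_1_right)
    show "of_nat (Suc n) * ((- 1) ^ i * of_nat (n choose i) * step recip a (Suc i)) =
        (- 1) ^ i * of_nat (Suc n choose Suc i) * psum a (Suc i)"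
      unfolding *[symmetric] step_def by (simp add: mult_ac)
  qed
  then have *: "of_nat (Suc n) * btrans (step recip a) (Suc n) = btrans a (Suc n)"
    by (simp only: sum_alternating_binomial_psum)
  have "btrans (step recip a) (Suc n) =
      (of_nat (Suc n) * recip (Suc n)) * btrans (step recip a) (Suc n)"
    by (simp only: recip_mult zero_less_Suc mult_1_left)
  also have "\<dots> = recip (Suc n) * btrans a (Suc n)"
    unfolding *[symmetric] by (simp only: mult_ac)
  finally show ?thesis .
qed

text \<open>With \<open>i = m - 1\<close>, this compares the coefficients of \<open>a (Suc i)\<close>:
  \<open>(n + 1 - x) - (i + 1 - x) = n - i\<close>, and \<open>(n - i) * (n choose i) = n * (n - 1 choose i)\<close>.
  The parameter \<open>x\<close> cancels, so it may be the indeterminate.\<close>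

lemma btrans_recurrence:
  "(of_nat (Suc n) - x) * btrans a (Suc n) =
    of_nat n * btrans a n + btrans (\<lambda>m. (of_nat m - x) * a m) (Suc n)"
proof -
  have "of_nat n * btrans a n =
      (\<Sum>i\<le>n. (- 1) ^ i * (of_nat (n - i) * of_nat (n choose i)) * a (Suc i))"
  proof (cases n)
    case (Suc p)
    have *: "of_nat (Suc p - i) * of_nat (Suc p choose i) =
        (of_nat (Suc p) * of_nat (p choose i) :: 'a)" for i
      using binomial_absorb_comp[of "Suc p" i] by (metis diff_Suc_1 of_nat_mult)
    have "(\<Sum>i\<le>n. (- 1) ^ i * (of_nat (n - i) * of_nat (n choose i)) * a (Suc i)) =
        (\<Sum>i\<le>p. (- 1) ^ i * (of_nat (n - i) * of_nat (n choose i)) * a (Suc i))"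
      by (simp add: Suc)
    then show ?thesis
      unfolding Suc * by (simp add: btrans_Suc sum_distrib_left mult_ac)
  qed simp
  then show ?thesis
    unfolding btrans_Suc sum_distrib_left sum.distrib[symmetric]
    by (simp add: sum.distrib[symmetric])
      (rule sum.cong, auto simp: of_nat_diff algebra_simps)
qed

definition Z :: "nat \<Rightarrow> real fps" where
  "Z n = (\<Prod>i=1..n. of_nat i * pole i)"

lemma Z_0: "Z 0 = 1" by (simp add: Z_def)

lemma Z_Suc: "Z (Suc n) = Z n * (of_nat (Suc n) * pole (Suc n))"
  by (simp add: Z_def)

text \<open>Dividing the binomial transform by \<open>Z\<close> is what makes the correspondence stable under the
  operators with \<open>pole\<close>. Values at 0 enter neither partial sums nor the transform, so only
  successors are compared.\<close>

definition transforms_to :: "(nat \<Rightarrow> real fps) \<Rightarrow> (nat \<Rightarrow> real fps) \<Rightarrow> bool" where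
  "transforms_to a b \<longleftrightarrow> (\<forall>n. btrans a (Suc n) = Z n * b (Suc n))"

lemma transforms_to_step_recip:
  "transforms_to a b \<Longrightarrow> transforms_to (step recip a) (\<lambda>n. recip n * b n)"
  by (simp add: transforms_to_def btrans_step_recip mult_ac)

text \<open>Let \<open>c n = a n / (n - X)\<close>. The recurrence of the transform at \<open>x = X\<close> reads
  \<open>(n + 1 - X) * T c (n + 1) = n * T c n + T a (n + 1)\<close>. The sequence \<open>Z (n - 1) / (n - X)\<close> solves
  the homogeneous equation, so after division by \<open>Z n\<close> the recurrence says that
  \<open>(n + 1 - X) * T c (n + 1) / Z n\<close> grows by \<open>b (n + 1)\<close> in each step, as partial sums of \<open>b\<close> do.\<close>

lemma transforms_to_mult_pole:
  assumes "transforms_to a b"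
  shows "transforms_to (\<lambda>n. pole n * a n) (step pole b)"
proof -
  let ?c = "\<lambda>n. pole n * a n"
  have a: "btrans (\<lambda>m. (of_nat m - fps_X) * ?c m) (Suc n) = btrans a (Suc n)" for n
    unfolding btrans_Suc mult.assoc[symmetric, of _ "pole _"]
    by (simp only: pole_mult zero_less_Suc mult_1_left)
  have solve: "btrans ?c (Suc n) = Z n * step pole b (Suc n)"
    if "of_nat n * btrans ?c n = Z n * psum b n" for n
  proof -
    have *: "(of_nat (Suc n) - fps_X) * btrans ?c (Suc n) = Z n * psum b (Suc n)"
      unfolding btrans_recurrence a that
      using assms by (simp add: transforms_to_def psum_Suc distrib_left)
    have "btrans ?c (Suc n) = ((of_nat (Suc n) - fps_X) * pole (Suc n)) * btrans ?c (Suc n)"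
      by (simp only: pole_mult zero_less_Suc mult_1_left)
    also have "\<dots> = pole (Suc n) * ((of_nat (Suc n) - fps_X) * btrans ?c (Suc n))"
      by (simp only: mult_ac)
    also have "\<dots> = Z n * step pole b (Suc n)"
      unfolding * step_def by (simp only: mult_ac)
    finally show ?thesis .
  qed
  have "btrans ?c (Suc n) = Z n * step pole b (Suc n)" for n
  proof (induction n)
    case 0
    show ?case by (rule solve) (simp add: psum_def)
  next
    case (Suc n)
    have "of_nat (Suc n) * btrans ?c (Suc n) = Z (Suc n) * psum b (Suc n)"
      unfolding Suc Z_Suc step_def by (simp only: mult_ac)
    then show ?case by (rule solve)
  qed
  then show ?thesis by (simp add: transforms_to_def)
qed

text \<open>The transform of the constant sequence 1 is concentrated at \<open>n = 1\<close>, by the vanishing of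
  alternating binomial sums, and has all its partial sums equal to 1. Applying
  one multiplication operator on the left and one summation operator on the right gives
  \<open>pole\<close> on both sides.\<close>

lemma transforms_to_pole: "transforms_to pole pole"
proof -
  have "transforms_to (\<lambda>_. 1) (\<lambda>n. of_bool (n = 1))"
  proof -
    have "btrans (\<lambda>_. 1 :: real fps) (Suc n) = of_bool (n = 0)" for n
      using choose_alternating_sum[of n, where 'a = "real fps"]
      by (cases "n = 0") (auto simp: btrans_Suc)
    then have "btrans (\<lambda>_. 1) (Suc n) = Z n * of_bool (Suc n = 1)" for n
      by (cases n) (simp_all add: Z_0)
    then show ?thesis by (simp add: transforms_to_def)
  qed
  from transforms_to_mult_pole[OF this] show ?thesis
    by (simp add: transforms_to_def step_def psum_def sum.delta)
qed

lemma transforms_to_fold: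
  "transforms_to a b \<Longrightarrow>
    transforms_to (fold (letter pole recip) w a) (fold (letter recip pole) (map Not w) b)"
  by (induction w arbitrary: a b)
    (auto simp: letter_def intro: transforms_to_step_recip transforms_to_mult_pole)

text \<open>Because \<open>n * (N choose n) = N * (N - 1 choose n - 1)\<close>, the sum is \<open>N\<close> times the binomial
  transform of \<open>a n / (n - X)\<close> at \<open>N\<close>; by \<open>transforms_to_mult_pole\<close> this is
  \<open>N / (N - X) * Z (N - 1) * psum b N\<close>, and the first two factors combine to \<open>Z N\<close>.\<close>

lemma sum_binomial_eq_Z_psum:
  assumes "transforms_to a b" "1 \<le> N"
  shows "(\<Sum>n=1..N. (- 1) ^ (n - 1) * of_nat (N choose n) * (of_nat n * pole n) * a n) =
    Z N * (\<Sum>n=1..N. b n)"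
proof -
  obtain M where N: "N = Suc M" using assms(2) by (cases N) auto
  have "(\<Sum>n=1..N. (- 1) ^ (n - 1) * of_nat (N choose n) * (of_nat n * pole n) * a n) =
      of_nat N * btrans (\<lambda>n. pole n * a n) N"
    unfolding btrans_def sum_distrib_left
  proof (rule sum.cong[OF refl])
    fix n assume "n \<in> {1..N}"
    then obtain i where n: "n = Suc i" by (cases n) auto
    have *: "of_nat n * of_nat (N choose n) = (of_nat N * of_nat (M choose i) :: real fps)"
      unfolding n N by (metis Suc_times_binomial of_nat_mult)
    have "(- 1) ^ (n - 1) * of_nat (N choose n) * (of_nat n * pole n) * a n =
        (of_nat n * of_nat (N choose n)) * ((- 1) ^ (n - 1) * (pole n * a n))"
      by (simp add: mult_ac)
    also have "\<dots> = of_nat N * ((- 1) ^ (n - 1) * of_nat ((N - 1) choose (n - 1)) * (pole n * a n))"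
      unfolding * by (simp add: n N mult_ac)
    finally show "(- 1) ^ (n - 1) * of_nat (N choose n) * (of_nat n * pole n) * a n = \<dots>" .
  qed
  also have "\<dots> = Z N * psum b N"
    using transforms_to_mult_pole[OF assms(1)]
    by (simp add: transforms_to_def N step_def Z_Suc mult_ac)
  finally show ?thesis by (simp add: psum_def)
qed

section \<open>The generating functions of the two sides\<close>

lemma zeta_star_snoc:
  "zeta_star N (k @ [y]) = (\<Sum>n=1..N. zeta_star n k / real n ^ y)"
  unfolding zeta_star_def length_append_singleton sum_weak_chains_Suc sum_divide_distrib
proof (intro sum.cong refl)
  fix n m assume "m \<in> weak_chains n (length k)"
  then have len: "length m = length k" by (simp add: weak_chains_def)
  have "(\<Prod>i<length k. real ((m @ [n]) ! i) ^ ((k @ [y]) ! i)) =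
      (\<Prod>i<length k. real (m ! i) ^ (k ! i))"
    by (rule prod.cong) (auto simp: nth_append len)
  then show "1 / (\<Prod>i<Suc (length k). real ((m @ [n]) ! i) ^ ((k @ [y]) ! i)) =
      1 / (\<Prod>i<length k. real (m ! i) ^ (k ! i)) / real n ^ y"
    by (simp add: nth_append len)
qed

text \<open>Both sides have the same recursion in \<open>N\<close>: comparing coefficients in
  \<open>(N + 1 - X) * Z (N + 1) = (N + 1) * Z N\<close> corresponds to splitting off the largest element
  of a chain.\<close>

lemma Z_nth: "Z N $ j = zeta_star N (replicate j 1)"
proof (induction j arbitrary: N)
  case 0
  have "Z N $ 0 = 1"
    by (induction N) (simp_all add: Z_0 Z_Suc fps_mult_of_nat_nth pole_eq)
  then show ?case by (simp add: zeta_star_Nil)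
next
  case (Suc j)
  have rep: "replicate (Suc j) (1::nat) = replicate j 1 @ [1]"
    by (simp add: replicate_append_same)
  have "Z N $ Suc j = (\<Sum>n=1..N. Z n $ j / real n)"
  proof (induction N)
    case (Suc N)
    have "(of_nat (Suc N) - fps_X) * Z (Suc N) =
        of_nat (Suc N) * Z N * ((of_nat (Suc N) - fps_X) * pole (Suc N))"
      by (simp only: Z_Suc mult_ac)
    then have "(of_nat (Suc N) - fps_X) * Z (Suc N) = of_nat (Suc N) * Z N"
      by (simp only: pole_mult zero_less_Suc mult_1_right)
    then have "((of_nat (Suc N) - fps_X) * Z (Suc N)) $ Suc j = (of_nat (Suc N) * Z N) $ Suc j"
      by (rule arg_cong)
    then have "real (Suc N) * Z (Suc N) $ Suc j - Z (Suc N) $ j = real (Suc N) * Z N $ Suc j"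
      by (simp only: left_diff_distrib fps_sub_nth fps_mult_of_nat_nth fps_X_mult_nth) simp
    then have "Z (Suc N) $ Suc j = Z N $ Suc j + Z (Suc N) $ j / real (Suc N)"
      by (simp add: field_simps)
    then show ?case using Suc.IH by simp
  qed (simp add: Z_0)
  then show ?case unfolding rep zeta_star_snoc by (simp add: Suc.IH)
qed

lemma tuple_add_nth:
  "length es = length k \<Longrightarrow> i < length k \<Longrightarrow> tuple_add k es ! i = k ! i + es ! i"
  by (simp add: tuple_add_def)

lemma length_tuple_add: "length es = length k \<Longrightarrow> length (tuple_add k es) = length k"
  by (simp add: tuple_add_def)

lemma weak_chains_nth_pos: "m \<in> weak_chains N r \<Longrightarrow> i < r \<Longrightarrow> 0 < m ! i"
  unfolding weak_chains_def using nth_mem by fastforce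

lemma sum_zeta_star_shift_nth:
  assumes "k \<noteq> []" "is_index k"
  shows "(\<Sum>es \<in> J j (length k). zeta_star N (tuple_add k es)) =
    (\<Sum>n=1..N. fold (letter recip pole) (tl (word k)) pole n) $ j"
proof -
  obtain x l where k: "k = x # l" using assms(1) by (cases k) auto
  let ?w = "\<lambda>y n. recip n ^ (y - 1) * pole n"
  have "(\<Sum>n=1..N. fold (letter recip pole) (tl (word k)) pole n) =
      (\<Sum>m \<in> weak_chains N (length k). \<Prod>i<length k. ?w (k ! i) (m ! i))"
    using sum_weak_chains_eq_fold_step[of "\<lambda>_. 1" "?w x" "map ?w l" N]
    unfolding k fold_letter_tl_word by (simp add: prod.lessThan_Suc_shift del: prod.lessThan_Suc)
  then have "(\<Sum>n=1..N. fold (letter recip pole) (tl (word k)) pole n) $ j =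
      (\<Sum>m \<in> weak_chains N (length k). \<Sum>es \<in> J j (length k).
        \<Prod>i<length k. ?w (k ! i) (m ! i) $ (es ! i))"
    using assms(1) by (simp add: fps_sum_nth fps_prod_nth_J)
  also have "\<dots> = (\<Sum>m \<in> weak_chains N (length k). \<Sum>es \<in> J j (length k).
        1 / (\<Prod>i<length k. real (m ! i) ^ (tuple_add k es ! i)))"
  proof (intro sum.cong refl)
    fix m es assume m: "m \<in> weak_chains N (length k)" and es: "es \<in> J j (length k)"
    have "(\<Prod>i<length k. ?w (k ! i) (m ! i) $ (es ! i)) =
        (\<Prod>i<length k. 1 / real (m ! i) ^ (tuple_add k es ! i))"
      using assms(2) es m
      by (intro prod.cong refl)
        (simp add: zeta_weight_nth[simplified] weak_chains_nth_pos is_index_def tuple_add_nth J_def)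
    then show "(\<Prod>i<length k. ?w (k ! i) (m ! i) $ (es ! i)) =
        1 / (\<Prod>i<length k. real (m ! i) ^ (tuple_add k es ! i))"
      by (simp add: prod_dividef)
  qed
  also have "\<dots> = (\<Sum>es \<in> J j (length k). zeta_star N (tuple_add k es))"
    by (subst sum.swap, rule sum.cong) (auto simp: zeta_star_def J_def length_tuple_add)
  finally show ?thesis by simp
qed

lemma signed_binomial_mult_nth:
  "((- 1) ^ p * of_nat c * f :: real fps) $ e = (- 1) ^ p * real c * f $ e"
proof -
  have "(- 1) ^ p * of_nat c * f = fps_const ((- 1) ^ p * real c) * f"
    by (cases "even p") (simp_all add: fps_of_nat[symmetric])
  then show ?thesis by (simp only: fps_mult_left_const_nth)
qed

text \<open>The proof moves the factors \<open>n / (n - X)\<close> at the first and at the last position into the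
  product over all positions, where they are the powers \<open>d\<close> of \<open>H_weight_nth\<close>. The one at the first
  position is hidden in the initial sequence, since \<open>1 / (n - X) = n / (n - X) * (1 / n)\<close>.\<close>

lemma sum_H_star_shift_nth:
  assumes "k \<noteq> []" "is_index k"
  shows "(\<Sum>es \<in> J e (length k). real (b_coeff k es) * H_star N (tuple_add k es)) =
    (\<Sum>n=1..N. (- 1) ^ (n - 1) * of_nat (N choose n) * (of_nat n * pole n) *
      fold (letter pole recip) (tl (word k)) pole n) $ e"
proof -
  obtain x l where k: "k = x # l" using assms(1) by (cases k) auto
  let ?r = "length k"
  have pos: "0 < ?r" using assms(1) by simp
  let ?w = "\<lambda>y n. pole n ^ (y - 1) * recip n"
  let ?d = "\<lambda>i. of_bool (i = 0) + of_bool (i = ?r - 1) :: nat"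
  let ?q = "\<lambda>n. of_nat n * pole n"
  let ?s = "\<lambda>n. (- 1) ^ (n - 1) * of_nat (N choose n)"
  let ?c = "\<lambda>m. (- 1) ^ (last m - 1) * real (N choose last m)"
  have "(\<Sum>n=1..N. ?s n * ?q n * fold (letter pole recip) (tl (word k)) pole n) =
      (\<Sum>m \<in> weak_chains N ?r. ?s (last m) * (?q (last m) * ((pole (m ! 0) ^ (x - 1) * pole (m ! 0)) *
        (\<Prod>i<length l. ?w (l ! i) (m ! Suc i)))))"
    using sum_weak_chains_eq_fold_step[of "\<lambda>n. ?s n * ?q n" "\<lambda>n. pole n ^ (x - 1) * pole n" "map ?w l" N]
    unfolding k fold_letter_tl_word by (simp add: mult.assoc)
  also have "\<dots> = (\<Sum>m \<in> weak_chains N ?r. ?s (last m) *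
      (\<Prod>i<?r. ?q (m ! i) ^ ?d i * ?w (k ! i) (m ! i)))"
  proof (intro sum.cong refl arg_cong2[where f = "(*)"])
    fix m assume m: "m \<in> weak_chains N ?r"
    then have len: "length m = Suc (length l)" by (simp add: weak_chains_def k)
    then have last: "last m = m ! (?r - 1)" by (subst last_conv_nth) (auto simp: k)
    have "0 < m ! 0" using weak_chains_nth_pos[OF m, of 0] by (simp add: k)
    have "?q (m ! 0) * ?w x (m ! 0) =
        pole (m ! 0) ^ (x - 1) * (of_nat (m ! 0) * recip (m ! 0)) * pole (m ! 0)"
      by (simp only: mult_ac)
    then have hd: "pole (m ! 0) ^ (x - 1) * pole (m ! 0) = ?q (m ! 0) * ?w x (m ! 0)"
      by (simp only: recip_mult[OF \<open>0 < m ! 0\<close>] mult_1_right)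
    have pw: "(\<Prod>i<?r. ?q (m ! i) ^ of_bool (i = j)) = ?q (m ! j)" if "j < ?r" for j
    proof -
      have "(\<Prod>i<?r. ?q (m ! i) ^ of_bool (i = j)) = (\<Prod>i<?r. if i = j then ?q (m ! i) else 1)"
        by (rule prod.cong) auto
      then show ?thesis using that by (simp add: prod.delta)
    qed
    have "(\<Prod>i<?r. ?q (m ! i) ^ ?d i * ?w (k ! i) (m ! i)) =
        (\<Prod>i<?r. ?q (m ! i) ^ of_bool (i = 0)) * (\<Prod>i<?r. ?q (m ! i) ^ of_bool (i = ?r - 1)) *
          (\<Prod>i<?r. ?w (k ! i) (m ! i))"
      by (simp only: power_add prod.distrib)
    also have "\<dots> = ?q (m ! 0) * ?q (last m) * (?w x (m ! 0) * (\<Prod>i<length l. ?w (l ! i) (m ! Suc i)))"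
      using pw[of 0] pw[of "?r - 1"] unfolding last
      by (simp add: k prod.lessThan_Suc_shift del: prod.lessThan_Suc)
    finally show "?q (last m) * ((pole (m ! 0) ^ (x - 1) * pole (m ! 0)) *
        (\<Prod>i<length l. ?w (l ! i) (m ! Suc i))) = (\<Prod>i<?r. ?q (m ! i) ^ ?d i * ?w (k ! i) (m ! i))"
      unfolding hd by (simp only: mult_ac)
  qed
  finally have "(\<Sum>n=1..N. ?s n * ?q n * fold (letter pole recip) (tl (word k)) pole n) $ e =
      (\<Sum>m \<in> weak_chains N ?r. ?c m *
        (\<Sum>es \<in> J e ?r. \<Prod>i<?r. (?q (m ! i) ^ ?d i * ?w (k ! i) (m ! i)) $ (es ! i)))"
    by (simp only: fps_sum_nth signed_binomial_mult_nth fps_prod_nth_J[OF pos])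
  also have "\<dots> = (\<Sum>m \<in> weak_chains N ?r. \<Sum>es \<in> J e ?r. real (b_coeff k es) *
        (?c m / (\<Prod>i<?r. real (m ! i) ^ (tuple_add k es ! i))))"
    unfolding sum_distrib_left
  proof (intro sum.cong refl)
    fix m es assume m: "m \<in> weak_chains N ?r" and es: "es \<in> J e ?r"
    have "(\<Prod>i<?r. (?q (m ! i) ^ ?d i * ?w (k ! i) (m ! i)) $ (es ! i)) =
        (\<Prod>i<?r. real ((k ! i + es ! i + ?d i - 2) choose (es ! i)) /
          real (m ! i) ^ (tuple_add k es ! i))"
    proof (intro prod.cong refl)
      fix i assume "i \<in> {..<?r}"
      then have i: "i < ?r" by simp
      have "0 < k ! i" using assms(2) i by (simp add: is_index_def)
      from H_weight_nth[OF weak_chains_nth_pos[OF m i] this, of "?d i" "es ! i"]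
      show "(?q (m ! i) ^ ?d i * ?w (k ! i) (m ! i)) $ (es ! i) =
          real ((k ! i + es ! i + ?d i - 2) choose (es ! i)) / real (m ! i) ^ (tuple_add k es ! i)"
        using es i by (simp only: tuple_add_nth J_def mem_Collect_eq)
    qed
    then have "(\<Prod>i<?r. (?q (m ! i) ^ ?d i * ?w (k ! i) (m ! i)) $ (es ! i)) =
        real (b_coeff k es) / (\<Prod>i<?r. real (m ! i) ^ (tuple_add k es ! i))"
      by (simp only: prod_dividef b_coeff_def of_nat_prod add.assoc)
    then show "?c m * (\<Prod>i<?r. (?q (m ! i) ^ ?d i * ?w (k ! i) (m ! i)) $ (es ! i)) =
        real (b_coeff k es) * (?c m / (\<Prod>i<?r. real (m ! i) ^ (tuple_add k es ! i)))"
      by (simp only: times_divide_eq_right mult_ac)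
  qed
  also have "\<dots> = (\<Sum>es \<in> J e ?r. real (b_coeff k es) * H_star N (tuple_add k es))"
    by (subst sum.swap, rule sum.cong)
      (auto simp: H_star_def J_def length_tuple_add sum_distrib_left)
  finally show ?thesis by simp
qed

theorem corollary2p2:
  fixes N e r s :: nat and k :: "nat list"
  assumes "N \<ge> 1" and "r \<ge> 1"
    and "is_index k" and "length k = r"
    and "s = length (hoffman_dual k)"
  shows "(\<Sum>es \<in> J e r. real (b_coeff k es) * H_star N (tuple_add k es)) =
    (\<Sum>j = 0..e. zeta_star N (replicate (e - j) 1) *
       (\<Sum>es' \<in> J j s. zeta_star N (tuple_add (hoffman_dual k) es')))"
proof -
  let ?F = "fold (letter pole recip) (tl (word k)) pole"
  let ?G = "fold (letter recip pole) (tl (word (hoffman_dual k))) pole"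
  have k: "k \<noteq> []" using assms by auto
  note dual = is_index_hoffman_dual[OF k assms(3)]
  have "tl (word (hoffman_dual k)) = map Not (tl (word k))"
    by (simp add: word_hoffman_dual[OF k assms(3)])
  then have F: "transforms_to ?F ?G"
    using transforms_to_fold[OF transforms_to_pole, of "tl (word k)"] by simp
  have "(\<Sum>es \<in> J e r. real (b_coeff k es) * H_star N (tuple_add k es)) =
      (Z N * (\<Sum>n=1..N. ?G n)) $ e"
    using sum_H_star_shift_nth[OF k assms(3)] sum_binomial_eq_Z_psum[OF F assms(1)] assms(4)
    by simp
  also have "\<dots> = (\<Sum>j=0..e. (\<Sum>n=1..N. ?G n) $ j * Z N $ (e - j))"
    by (subst mult.commute) (rule fps_mult_nth)
  also have "\<dots> = (\<Sum>j=0..e. zeta_star N (replicate (e - j) 1) *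
      (\<Sum>es' \<in> J j s. zeta_star N (tuple_add (hoffman_dual k) es')))"
    unfolding assms(5) Z_nth using sum_zeta_star_shift_nth dual by (simp add: mult.commute)
  finally show ?thesis .
qed

end
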